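(* Let $\alpha\in(0,2)$ and $H>0$. Let $\{\psi_c\}_{c>0}$ be the cyclic flow on the space $Z\times[0,q(\cdot))=\{(z,v):z\in Z,\ 0\le v<q(z)\}$ given by $$\psi_c(z,v)=(z,\{v+\ln c\}_{q(z)}),\quad c>0,$$ where $q(z)>0$ is a measurable function on $Z$ and $\sigma(dz)$ is a measure on $Z$. Choose the version $$\frac{d((\sigma\otimes\mathbb{L})\circ\psi_c)}{d(\sigma\otimes\mathbb{L})}(z,v)\equiv1$$ of the Radon-Nikodym derivatives, which is a cocycle for the flow, where $\mathbb{L}$ is Lebesgue measure on $\mathbb{R}$. Let $\{b_c\}_{c>0}$ be a cocycle for $\{\psi_c\}_{c>0}$ with values in $\{-1,1\}$, expressed as $$b_c(z,v)=b_1(z)^{[v+\ln c]_{q(z)}}\,\frac{b(\psi_c(z,v))}{b(z,v)}$$ with functions $b_1:Z\to\{-1,1\}$ and $b:Z\times[0,q(\cdot))\to\{-1,1\}$. Let $\{j_c\}_{c>0}$ be a $2$-semi-additive functional for the flow $\{\psi_c\}_{c>0}$ and the cocycle $\{b_c\}_{c>0}$, i.e. (with the version of the Radon-Nikodym derivatives $d((\sigma\otimes\mathbb{L})\circ\psi_c)/d(\sigma\otimes\mathbb{L})$ that is identically equal to $1$) a measurable function $j_c(z,v):(0,\infty)\times(Z\times[0,q(\cdot)))\to\mathbb{R}$ with $$j_{c_1c_2}(z,v)=c_2^{-(H-1/\alpha)}j_{c_1}(z,v)+b_{c_1}(z,v)\,j_{c_2}(\psi_{c_1}(z,v))$$ for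 all $c_1,c_2>0$ and $(z,v)\in Z\times[0,q(\cdot))$. Then there are functions $j_1:Z\to\mathbb{R}$ and $j:Z\times[0,q(\cdot))\to\mathbb{R}$ such that $$j_c(z,v)=b_1(z)^{[v+\ln c]_{q(z)}}\frac{b(\psi_c(z,v))}{b(z,v)}\,j(\psi_c(z,v))-c^{-(H-1/\alpha)}j(z,v)+\frac{j_1(z)}{b(z,v)}\,[v+\ln c]_{q(z)}\,1_{\{b_1(z)=1\}}\,1_{\{H=1/\alpha\}}$$ for all $c>0$ and $(z,v)\in Z\times[0,q(\cdot))$.
   Context: For $v\in\mathbb{R}$ and $a>0$: $[v]_a=\max\{n\in\mathbb{Z}:na\le v\}$ and $\{v\}_a=v-a[v]_a$. $(Z,\mathcal{Z},\sigma)$ is a standard Lebesgue space (standard Borel space with a $\sigma$-finite measure) and $Z\times[0,q(\cdot))$ carries the measure $\sigma(dz)dv$. A cocycle for the flow with values in $\{-1,1\}$ is a measurable map $(c,x)\mapsto b_c(x)\in\{-1,1\}$ on $(0,\infty)\times(Z\times[0,q(\cdot)))$ with $b_{c_1c_2}(x)=b_{c_1}(x)b_{c_2}(\psi_{c_1}(x))$ for all $c_1,c_2>0$ and all $x$; it is known that every such cocycle for this cyclic flow can be expressed in the form displayed in the claim. The symbols $b_1$ and $j_1$ denote functions on $Z$, not the values of $b_c$ and $j_c$ at $c=1$. $1_{\{\cdot\}}$ denotes the indicator. *)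

theory Defs
  imports "HOL-Analysis.Analysis"
begin

section \<open>Standard Lebesgue spaces\<close>

definition standard_borel :: "'a measure \<Rightarrow> bool" where
  "standard_borel M \<longleftrightarrow>
     (\<exists>T. completely_metrizable_space T \<and> second_countable T \<and>
          space M = topspace T \<and>
          sets M = sigma_sets (topspace T) {U. openin T U})"

definition standard_lebesgue_space :: "'a measure \<Rightarrow> bool" where
  "standard_lebesgue_space M \<longleftrightarrow> standard_borel M \<and> sigma_finite_measure M"

section \<open>Integer and fractional parts relative to a period\<close>

definition ipart :: "real \<Rightarrow> real \<Rightarrow> int" where
  "ipart a v = (GREATEST n::int. of_int n * a \<le> v)"

definition fpart :: "real \<Rightarrow> real \<Rightarrow> real" where
  "fpart a v = v - a * of_int (ipart a v)"

lemma ipart_eq_floor: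
  assumes "a > 0" shows "ipart a v = \<lfloor>v / a\<rfloor>"
  unfolding ipart_def
proof (rule Greatest_equality)
  show "of_int \<lfloor>v / a\<rfloor> * a \<le> v"
    using assms by (simp add: pos_le_divide_eq [symmetric])
next
  fix y :: int assume "of_int y * a \<le> v"
  then show "y \<le> \<lfloor>v / a\<rfloor>"
    using assms by (simp add: le_floor_iff pos_le_divide_eq)
qed

section \<open>Cocycles and functionals of multiplicative flows\<close>

text \<open>A flow on (the space of) a measure \<open>M\<close> is a family \<open>\<psi>\<close> of maps of which only the members
  with positive index matter.\<close>

definition flow_cocycle ::
  "'x measure \<Rightarrow> (real \<Rightarrow> 'x \<Rightarrow> 'x) \<Rightarrow> real set \<Rightarrow> (real \<Rightarrow> 'x \<Rightarrow> real) \<Rightarrow> bool" where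
  "flow_cocycle M \<psi> A b \<longleftrightarrow>
     (\<lambda>(c, x). b c x) \<in> borel_measurable (restrict_space borel {0<..} \<Otimes>\<^sub>M M) \<and>
     (\<forall>c>0. \<forall>x\<in>space M. b c x \<in> A) \<and>
     (\<forall>c1>0. \<forall>c2>0. \<forall>x\<in>space M. b (c1 * c2) x = b c1 x * b c2 (\<psi> c1 x))"

text \<open>\<open>D c\<close> is a version of the Radon-Nikodym derivative of \<open>M \<circ> \<psi>\<^sub>c\<close>, the measure
  \<open>A \<mapsto> M (\<psi>\<^sub>c A)\<close>, with respect to \<open>M\<close>. The maps \<open>\<psi>\<^sub>c\<close> of a flow are measurable bijections
  with measurable inverses, so that the images are measurable.\<close>

definition RN_version ::
  "'x measure \<Rightarrow> (real \<Rightarrow> 'x \<Rightarrow> 'x) \<Rightarrow> (real \<Rightarrow> 'x \<Rightarrow> real) \<Rightarrow> bool" where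
  "RN_version M \<psi> D \<longleftrightarrow>
     (\<forall>c>0. D c \<in> borel_measurable M \<and> (\<forall>x\<in>space M. 0 \<le> D c x) \<and>
            (\<forall>A\<in>sets M. emeasure M (\<psi> c ` A) = (\<integral>\<^sup>+x\<in>A. ennreal (D c x) \<partial>M)))"

text \<open>The derivatives enter the definition for a general flow with the exponent \<open>1 / \<alpha>\<close>; the
  factor is \<open>1\<close> for the version of the derivatives that is identically \<open>1\<close>.\<close>

definition semi_additive2 ::
  "real \<Rightarrow> real \<Rightarrow> 'x measure \<Rightarrow> (real \<Rightarrow> 'x \<Rightarrow> 'x) \<Rightarrow> (real \<Rightarrow> 'x \<Rightarrow> real) \<Rightarrow>
   (real \<Rightarrow> 'x \<Rightarrow> real) \<Rightarrow> (real \<Rightarrow> 'x \<Rightarrow> real) \<Rightarrow> bool" where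
  "semi_additive2 \<alpha> H M \<psi> D b j \<longleftrightarrow>
     (\<lambda>(c, x). j c x) \<in> borel_measurable (restrict_space borel {0<..} \<Otimes>\<^sub>M M) \<and>
     (\<forall>c1>0. \<forall>c2>0. \<forall>x\<in>space M.
        j (c1 * c2) x = c2 powr (- (H - 1 / \<alpha>)) * j c1 x
          + b c1 x * (D c1 x) powr (1 / \<alpha>) * j c2 (\<psi> c1 x))"

section \<open>The cyclic flow\<close>

definition cyclic_measure :: "'z measure \<Rightarrow> ('z \<Rightarrow> real) \<Rightarrow> ('z \<times> real) measure" where
  "cyclic_measure \<sigma> q =
     restrict_space (\<sigma> \<Otimes>\<^sub>M lborel) {(z, v). z \<in> space \<sigma> \<and> 0 \<le> v \<and> v < q z}"

definition cyclic_flow :: "('z \<Rightarrow> real) \<Rightarrow> real \<Rightarrow> 'z \<times> real \<Rightarrow> 'z \<times> real" where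
  "cyclic_flow q c = (\<lambda>(z, v). (z, fpart (q z) (v + ln c)))"

lemma space_cyclic_measure:
  "space (cyclic_measure \<sigma> q) = {(z, v). z \<in> space \<sigma> \<and> 0 \<le> v \<and> v < q z}"
  by (auto simp: cyclic_measure_def space_restrict_space space_pair_measure)

lemma fpart_bounds:
  assumes "a > 0" shows "0 \<le> fpart a v" "fpart a v < a"
proof -
  have "of_int \<lfloor>v / a\<rfloor> \<le> v / a" "v / a < of_int \<lfloor>v / a\<rfloor> + 1" by linarith+
  then have "of_int \<lfloor>v / a\<rfloor> * a \<le> v" "v < (of_int \<lfloor>v / a\<rfloor> + 1) * a"
    using assms by (simp_all only: pos_le_divide_eq pos_divide_less_eq)
  then show "0 \<le> fpart a v" "fpart a v < a"
    using assms by (simp_all add: fpart_def ipart_eq_floor algebra_simps)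
qed

lemma fpart_shift:
  assumes "a > 0" shows "fpart a (v + a * of_int n) = fpart a v"
proof -
  have "(v + a * of_int n) / a = v / a + of_int n" using assms by (simp add: field_simps)
  then have "\<lfloor>(v + a * of_int n) / a\<rfloor> = \<lfloor>v / a\<rfloor> + n" by simp
  then show ?thesis using assms by (simp add: fpart_def ipart_eq_floor algebra_simps)
qed

lemma fpart_ident:
  assumes "0 \<le> v" "v < a" shows "fpart a v = v"
proof -
  have "\<lfloor>v / a\<rfloor> = 0" using assms by (simp add: floor_eq_iff)
  then show ?thesis using assms by (simp add: fpart_def ipart_eq_floor)
qed

lemma fpart_add_fpart:
  assumes "a > 0" shows "fpart a (fpart a v + t) = fpart a (v + t)"
  using fpart_shift[OF assms, of "v + t" "- ipart a v"] by (simp add: fpart_def algebra_simps)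

lemma cyclic_flow_mult:
  assumes "c1 > 0" "c2 > 0" "q (fst x) > 0"
  shows "cyclic_flow q (c1 * c2) x = cyclic_flow q c2 (cyclic_flow q c1 x)"
  using assms
  by (simp add: cyclic_flow_def ln_mult fpart_add_fpart split_beta add.assoc)

lemma cyclic_flow_one:
  assumes "x \<in> space (cyclic_measure \<sigma> q)"
  shows "cyclic_flow q 1 x = x"
  using assms by (auto simp: space_cyclic_measure cyclic_flow_def fpart_ident)

text \<open>The cyclic flow preserves the measure, hence the constant \<open>1\<close> is a version of the
  Radon-Nikodym derivatives.\<close>

lemma emeasure_fpart_image:
  fixes B :: "real set"
  assumes a: "a > 0" and B: "B \<in> sets borel" "B \<subseteq> {0..<a}"
  shows "emeasure lborel ((\<lambda>v. fpart a (v + t)) ` B) = emeasure lborel B"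
proof -
  define s where "s = fpart a t"
  have s: "0 \<le> s" "s < a" using fpart_bounds[OF a] by (auto simp: s_def)
  have st: "fpart a (v + t) = fpart a (v + s)" for v
    using fpart_add_fpart[OF a, of t v] by (simp add: s_def add.commute)
  define B1 where "B1 = B \<inter> {..<a - s}"
  define B2 where "B2 = B \<inter> {a - s..}"
  have [measurable]: "B1 \<in> sets borel" "B2 \<in> sets borel" using B by (auto simp: B1_def B2_def)
  have 1: "fpart a (v + t) = s + v" if "v \<in> B1" for v
    unfolding st using that B s fpart_ident[of "v + s" a] by (auto simp: B1_def add.commute)
  have 2: "fpart a (v + t) = (s - a) + v" if "v \<in> B2" for v
  proof -
    have "fpart a (v + s) = fpart a (v + s - a)"
      using fpart_shift[OF a, of "v + s" "-1"] by simp
    also have "\<dots> = v + s - a" using that B s by (intro fpart_ident) (auto simp: B2_def)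
    finally show ?thesis by (simp add: st)
  qed
  have tr: "emeasure lborel ((+) r ` C) = emeasure lborel C \<and> (+) r ` C \<in> sets borel"
    if "C \<in> sets borel" for r and C :: "real set"
  proof -
    have eq: "(+) r ` C = (+) (- r) -` C" by force
    have "emeasure lborel C = emeasure (distr lborel borel ((+) (- r))) C"
      by (simp add: lborel_distr_plus)
    also have "\<dots> = emeasure lborel ((+) (- r) -` C)"
      using that by (subst emeasure_distr) auto
    moreover have "(+) (- r) -` C \<in> sets borel"
      using that measurable_sets_borel[of "(+) (- r)" borel C] by simp
    ultimately show ?thesis using eq by simp
  qed
  have U: "B = B1 \<union> B2" by (auto simp: B1_def B2_def)
  have im: "(\<lambda>v. fpart a (v + t)) ` B = (+) s ` B1 \<union> (+) (s - a) ` B2"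
    unfolding U image_Un using 1 2 by (intro arg_cong2[where f="(\<union>)"] image_cong) auto
  have "(+) s ` B1 \<inter> (+) (s - a) ` B2 = {}"
  proof -
    have "s + v \<noteq> s - a + w" if "v \<in> B1" "w \<in> B2" for v w
    proof -
      have "v \<in> {0..<a}" "w \<in> {0..<a}" using that B(2) by (auto simp: B1_def B2_def)
      then show ?thesis by auto
    qed
    then show ?thesis by blast
  qed
  then have "emeasure lborel ((\<lambda>v. fpart a (v + t)) ` B) = 
      emeasure lborel ((+) s ` B1) + emeasure lborel ((+) (s - a) ` B2)"
    unfolding im using tr by (intro plus_emeasure [symmetric]) auto
  also have "\<dots> = emeasure lborel B1 + emeasure lborel B2"
    using tr by simp
  also have "\<dots> = emeasure lborel (B1 \<union> B2)"
    by (intro plus_emeasure) (use B(1) in \<open>auto simp: B1_def B2_def\<close>)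
  finally show ?thesis using U by simp
qed

lemma RN_version_cyclic_flow_one:
  assumes q[measurable]: "q \<in> borel_measurable \<sigma>" and q0: "\<And>z. z \<in> space \<sigma> \<Longrightarrow> q z > 0"
  shows "RN_version (cyclic_measure \<sigma> q) (cyclic_flow q) (\<lambda>c x. 1)"
  unfolding RN_version_def
proof (intro allI impI conjI ballI)
  fix c :: real and A assume c: "c > 0" and A: "A \<in> sets (cyclic_measure \<sigma> q)"
  define X where "X = {(z, v). z \<in> space \<sigma> \<and> 0 \<le> v \<and> v < q z}"
  define N where "N = \<sigma> \<Otimes>\<^sub>M (lborel :: real measure)"
  have M: "cyclic_measure \<sigma> q = restrict_space N X"
    by (simp add: cyclic_measure_def X_def N_def)
  have "X = {x \<in> space N. 0 \<le> snd x \<and> snd x < q (fst x)}"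
    by (auto simp: X_def N_def space_pair_measure)
  also have "\<dots> \<in> sets N" unfolding N_def by measurable
  finally have X: "X \<in> sets N" .
  then have XN: "X \<inter> space N \<in> sets N" by simp
  have AN: "A \<in> sets N" "A \<subseteq> X"
    using A XN unfolding M by (auto simp: sets_restrict_space_iff)
  let ?f = "cyclic_flow q c" and ?g = "cyclic_flow q (1 / c)"
  have gf: "?g (?f x) = x" "?f (?g x) = x" "?f x \<in> X" "?g x \<in> X" if "x \<in> X" for x
  proof -
    have qx: "q (fst x) > 0" using that q0 by (auto simp: X_def)
    have xs: "x \<in> space (cyclic_measure \<sigma> q)"
      using that by (simp add: space_cyclic_measure X_def)
    show "?g (?f x) = x" "?f (?g x) = x"
      using cyclic_flow_mult[of c "1 / c" q x] cyclic_flow_mult[of "1 / c" c q x] c qx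
        cyclic_flow_one[OF xs] by auto
    show "?f x \<in> X" "?g x \<in> X"
      using that q0 fpart_bounds by (auto simp: X_def cyclic_flow_def)
  qed
  define g' where "g' x = (fst x, (snd x + ln (1 / c)) - q (fst x) * of_int \<lfloor>(snd x + ln (1 / c)) / q (fst x)\<rfloor>)"
    for x :: "'a \<times> real"
  have g': "?g x = g' x" if "x \<in> X" for x
    using that q0 by (auto simp: X_def cyclic_flow_def g'_def fpart_def ipart_eq_floor)
  have [measurable]: "g' \<in> N \<rightarrow>\<^sub>M N" unfolding g'_def N_def by measurable
  have "?f ` A = X \<inter> (g' -` A \<inter> space N)"
  proof (intro equalityI subsetI)
    fix y assume "y \<in> ?f ` A"
    then obtain x where x: "x \<in> A" "y = ?f x" by blast
    then show "y \<in> X \<inter> (g' -` A \<inter> space N)"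
      using AN(2) gf[of x] g'[of y] sets.sets_into_space[OF X] by auto
  next
    fix y assume "y \<in> X \<inter> (g' -` A \<inter> space N)"
    then have "?g y \<in> A" "y \<in> X" using g'[of y] by auto
    then show "y \<in> ?f ` A" using gf(2)[of y] by (metis imageI)
  qed
  also have "\<dots> \<in> sets N" using X AN(1) by measurable
  finally have fAN: "?f ` A \<in> sets N" .
  have fAX: "?f ` A \<subseteq> X" using gf AN(2) by auto
  have "emeasure N (?f ` A) = (\<integral>\<^sup>+z. emeasure lborel (Pair z -` (?f ` A)) \<partial>\<sigma>)"
    using fAN unfolding N_def by (rule lborel.emeasure_pair_measure_alt)
  also have "\<dots> = (\<integral>\<^sup>+z. emeasure lborel (Pair z -` A) \<partial>\<sigma>)"
  proof (rule nn_integral_cong)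
    fix z assume z: "z \<in> space \<sigma>"
    have "Pair z -` (?f ` A) = (\<lambda>v. fpart (q z) (v + ln c)) ` (Pair z -` A)"
      by (force simp: cyclic_flow_def)
    moreover have "Pair z -` A \<in> sets borel"
      using sets_Pair1[of A \<sigma> lborel z] AN(1) by (simp add: N_def)
    moreover have "Pair z -` A \<subseteq> {0..<q z}" using AN(2) by (auto simp: X_def)
    ultimately show "emeasure lborel (Pair z -` (?f ` A)) = emeasure lborel (Pair z -` A)"
      using emeasure_fpart_image[OF q0[OF z]] by simp
  qed
  also have "\<dots> = emeasure N A"
    using AN(1) unfolding N_def by (rule lborel.emeasure_pair_measure_alt [symmetric])
  finally have "emeasure N (?f ` A) = emeasure N A" .
  then have "emeasure (cyclic_measure \<sigma> q) (?f ` A) = emeasure (cyclic_measure \<sigma> q) A"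
    unfolding M using XN AN(2) fAX by (simp add: emeasure_restrict_space)
  also have "\<dots> = (\<integral>\<^sup>+x\<in>A. ennreal 1 \<partial>cyclic_measure \<sigma> q)"
    using A by simp
  finally show "emeasure (cyclic_measure \<sigma> q) (?f ` A)
      = (\<integral>\<^sup>+x\<in>A. ennreal 1 \<partial>cyclic_measure \<sigma> q)" .
qed auto

end

theory Submission
  imports Defs
begin

text \<open>
  Over a fixed \<open>z\<close> every point lies on the orbit of \<open>(z, 0)\<close>, so the functional is determined by
  \<open>J t = j\<^bsub>exp t\<^esub>(z, 0)\<close>. The values \<open>K n = J (n * q)\<close> at the multiples of the period \<open>q\<close> satisfy
  \<open>K (m + n) = r\<^sup>n * K m + b1\<^sup>m * K n\<close> with \<open>r = exp (- (H - 1/\<alpha>) * q)\<close>. Exchanging \<open>m\<close> and \<open>n\<close>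
  shows that \<open>K n\<close> is a multiple of \<open>b1\<^sup>n - r\<^sup>n\<close> unless \<open>b1 = r\<close>, which happens only for \<open>b1 = 1\<close>
  and \<open>H = 1/\<alpha>\<close>; in that case \<open>K\<close> is additive and produces the term with \<open>j\<^sub>1\<close>.
\<close>

lemma twisted_additive_int_solution:
  fixes K :: "int \<Rightarrow> 'a::field"
  assumes "\<And>m n. K (m + n) = r powi n * K m + \<beta> powi m * K n" and "\<beta> \<noteq> r"
  shows "K n = K 1 / (\<beta> - r) * (\<beta> powi n - r powi n)"
proof -
  \<comment> \<open>Both sides equal \<open>K (n + 1)\<close>, split as \<open>1 + n\<close> and as
    \<open>n + 1\<close>.\<close>
  have "r powi n * K 1 + \<beta> * K n = r * K n + \<beta> powi n * K 1"
    using assms(1)[of 1 n] assms(1)[of n 1] by (simp add: add.commute)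
  then have "(\<beta> - r) * K n = K 1 * (\<beta> powi n - r powi n)"
    by (simp add: algebra_simps)
  then show ?thesis
    using assms(2) by (simp add: field_simps)
qed

lemma additive_int_linear:
  fixes K :: "int \<Rightarrow> 'a::comm_ring_1"
  assumes "\<And>m n. K (m + n) = K m + K n"
  shows "K n = of_int n * K 1"
proof -
  have "K 0 = 0" using assms[of 0 0] by simp
  then show ?thesis
  proof (induction n rule: int_induct[where k=0])
    case (step2 i)
    have "K i = K (i - 1) + K 1" using assms[of "i - 1" 1] by simp
    with step2 show ?case by (simp add: algebra_simps)
  qed (simp_all add: assms algebra_simps)
qed

text \<open>If \<open>\<beta> = exp (- \<kappa> * q)\<close>, then \<open>A = 0\<close> because of \<open>x / 0 = 0\<close>, so one formula covers both cases.\<close>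

lemma semi_additive_along_periodic_orbit:
  fixes J :: "real \<Rightarrow> real" and \<kappa> q \<beta> :: real
  assumes "q > 0" and \<beta>: "\<beta> \<in> {-1, 1}"
    and J: "\<And>n w. J (of_int n * q + w) = exp (- \<kappa> * w) * J (of_int n * q) + \<beta> powi n * J w"
  defines "A \<equiv> J q / (\<beta> - exp (- \<kappa> * q))"
  shows "J (of_int n * q + w) =
           \<beta> powi n * (J w + A * exp (- \<kappa> * w)) - A * exp (- \<kappa> * (of_int n * q + w))
           + of_int n * J q * of_bool (\<beta> = 1) * of_bool (\<kappa> = 0)"
proof -
  define r where "r = exp (- \<kappa> * q)"
  define K where "K m = J (of_int m * q)" for m
  have K1: "K 1 = J q" by (simp add: K_def)
  have r: "r powi m = exp (- \<kappa> * (of_int m * q))" for m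
    unfolding r_def by (simp add: exp_power_int mult_ac)
  have K: "K (k + m) = r powi m * K k + \<beta> powi k * K m" for k m
    using J[of k "of_int m * q"] by (simp add: K_def r algebra_simps)
  show ?thesis
  proof (cases "\<beta> = r")
    case True
    \<comment> \<open>An exponential is positive, which excludes \<open>-1\<close>; then
      \<open>exp (- \<kappa> * q) = 1\<close> with \<open>q > 0\<close> forces
      \<open>\<kappa> = 0\<close>.\<close>
    then have "\<beta> > 0" by (simp add: r_def)
    then have "\<beta> = 1" using \<beta> by auto
    with True have "\<kappa> = 0" using \<open>q > 0\<close> by (simp add: r_def)
    have "K n = of_int n * J q"
      using additive_int_linear[of K n] K K1 True \<open>\<beta> = 1\<close> by simp
    then show ?thesis
      using J[of n w] \<open>\<beta> = 1\<close> \<open>\<kappa> = 0\<close> by (simp add: K_def A_def)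
  next
    case False
    then have ind: "\<not> (\<beta> = 1 \<and> \<kappa> = 0)" by (auto simp: r_def)
    have "K n = A * (\<beta> powi n - r powi n)"
      using twisted_additive_int_solution[of K r \<beta> n] K False by (simp add: A_def K1 r_def)
    then have "J (of_int n * q) = A * (\<beta> powi n - exp (- \<kappa> * (of_int n * q)))"
      by (simp add: K_def r)
    \<comment> \<open>In \<open>exp (- \<kappa> * w) * K n\<close> the \<open>\<beta>\<close> part
      of \<open>K n\<close> joins \<open>J w\<close>, and the \<open>r\<close> part becomes an
      exponential of the whole argument.\<close>
    moreover have "exp (- \<kappa> * (of_int n * q + w)) = exp (- \<kappa> * (of_int n * q)) * exp (- \<kappa> * w)"
      by (simp add: exp_add [symmetric] algebra_simps)
    moreover have "of_bool (\<beta> = 1) * of_bool (\<kappa> = 0) = (0 :: real)"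
      using ind by simp
    ultimately show ?thesis
      unfolding J[of n w] by (simp only: mult.assoc) (simp add: algebra_simps)
  qed
qed

theorem proposition5p2:
  fixes \<sigma> :: "'z measure"
    and q b1 :: "'z \<Rightarrow> real"
    and b :: "'z \<times> real \<Rightarrow> real"
    and D bc jc :: "real \<Rightarrow> 'z \<times> real \<Rightarrow> real"
    and \<alpha> H :: real
  assumes "0 < \<alpha>" "\<alpha> < 2" "H > 0"
    and "standard_lebesgue_space \<sigma>"
    and "q \<in> borel_measurable \<sigma>"
    and "\<forall>z\<in>space \<sigma>. q z > 0"
    and "RN_version (cyclic_measure \<sigma> q) (cyclic_flow q) D"
    and "\<forall>c>0. \<forall>x\<in>space (cyclic_measure \<sigma> q). D c x = 1"
    and "flow_cocycle (cyclic_measure \<sigma> q) (cyclic_flow q) {-1, 1} bc"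
    and "\<forall>z\<in>space \<sigma>. b1 z \<in> {-1, 1}"
    and "\<forall>x\<in>space (cyclic_measure \<sigma> q). b x \<in> {-1, 1}"
    and "\<forall>c>0. \<forall>(z, v)\<in>space (cyclic_measure \<sigma> q).
           bc c (z, v) = b1 z powi ipart (q z) (v + ln c)
                         * (b (cyclic_flow q c (z, v)) / b (z, v))"
    and "semi_additive2 \<alpha> H (cyclic_measure \<sigma> q) (cyclic_flow q) D bc jc"
  shows "\<exists>(j1 :: 'z \<Rightarrow> real) (j :: 'z \<times> real \<Rightarrow> real).
           \<forall>c>0. \<forall>(z, v)\<in>space (cyclic_measure \<sigma> q).
             jc c (z, v) =
               b1 z powi ipart (q z) (v + ln c)
                 * (b (cyclic_flow q c (z, v)) / b (z, v)) * j (cyclic_flow q c (z, v))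
               - c powr (- (H - 1 / \<alpha>)) * j (z, v)
               + j1 z / b (z, v) * of_int (ipart (q z) (v + ln c))
                 * of_bool (b1 z = 1) * of_bool (H = 1 / \<alpha>)"
proof -
  let ?X = "space (cyclic_measure \<sigma> q)"
  define \<kappa> where "\<kappa> = H - 1 / \<alpha>"
  define J where "J z t = jc (exp t) (z, 0)" for z t
  define A where "A z = J z (q z) / (b1 z - exp (- \<kappa> * q z))" for z
  \<comment> \<open>The factor \<open>b (z, 0) / b (z, v)\<close> moves the base point of the orbit
    from \<open>(z, 0)\<close> to \<open>(z, v)\<close>. The summand with \<open>A z\<close> absorbs
    the exponential that the orbit formula leaves at time \<open>v + ln c\<close>.\<close>
  define j1 where "j1 z = b (z, 0) * J z (q z)" for z
  define j where "j = (\<lambda>(z, v). b (z, 0) * (J z v + A z * exp (- \<kappa> * v)) / b (z, v))"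
  have bc: "bc c (z, v) = b1 z powi ipart (q z) (v + ln c) * (b (cyclic_flow q c (z, v)) / b (z, v))"
    if "c > 0" "(z, v) \<in> ?X" for c z v
    using assms(12) that by fastforce
  have sa: "jc (c1 * c2) x = exp (- \<kappa> * ln c2) * jc c1 x + bc c1 x * jc c2 (cyclic_flow q c1 x)"
    if "c1 > 0" "c2 > 0" "x \<in> ?X" for c1 c2 x
    using assms(8,13) that by (simp add: semi_additive2_def powr_def \<kappa>_def)
  have "jc c (z, v) =
          b1 z powi ipart (q z) (v + ln c)
            * (b (cyclic_flow q c (z, v)) / b (z, v)) * j (cyclic_flow q c (z, v))
          - c powr (- (H - 1 / \<alpha>)) * j (z, v)
          + j1 z / b (z, v) * of_int (ipart (q z) (v + ln c))
            * of_bool (b1 z = 1) * of_bool (H = 1 / \<alpha>)"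
    if c: "c > 0" and x: "(z, v) \<in> ?X" for c z v
  proof -
    have z: "z \<in> space \<sigma>" and v: "0 \<le> v" "v < q z" using x by (auto simp: space_cyclic_measure)
    have q: "q z > 0" and \<beta>: "b1 z \<in> {-1, 1}" using assms(6,10) z by auto
    define n where "n = ipart (q z) (v + ln c)"
    define w where "w = fpart (q z) (v + ln c)"
    have flow: "cyclic_flow q c (z, v) = (z, w)" by (simp add: cyclic_flow_def w_def)
    have w: "0 \<le> w" "w < q z" using fpart_bounds[OF q] by (simp_all add: w_def)
    have nw: "v + ln c = of_int n * q z + w" by (simp add: n_def w_def fpart_def)
    have X: "(z, u) \<in> ?X" if "0 \<le> u" "u < q z" for u
      using that z by (simp add: space_cyclic_measure)
    have bsq: "b (z, u) * b (z, u) = 1" "b (z, u) \<noteq> 0" if "0 \<le> u" "u < q z" for u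
      using assms(11) X[OF that] by fastforce+
    \<comment> \<open>After \<open>m\<close> full periods the flow is back at \<open>(z, 0)\<close>,
      so the quotient of values of \<open>b\<close> is 1 and the cocycle is just
      \<open>b1 z powi m\<close>.\<close>
    have per: "J z (of_int m * q z + u) =
        exp (- \<kappa> * u) * J z (of_int m * q z) + b1 z powi m * J z u" for m u
    proof -
      have "fpart (q z) (of_int m * q z) = 0"
        using fpart_shift[OF q, of 0 m] fpart_ident[of 0 "q z"] q by (simp add: mult.commute)
      then have fl: "cyclic_flow q (exp (of_int m * q z)) (z, 0) = (z, 0)"
        by (simp add: cyclic_flow_def)
      have "ipart (q z) (of_int m * q z) = m" using q by (simp add: ipart_eq_floor)
      then have "bc (exp (of_int m * q z)) (z, 0) = b1 z powi m"
        using bc[of "exp (of_int m * q z)" z 0] X[of 0] bsq[of 0] q fl by simp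
      then show ?thesis
        using sa[of "exp (of_int m * q z)" "exp u" "(z, 0)"] X[of 0] q fl
        by (simp add: J_def exp_add)
    qed
    \<comment> \<open>The flow takes \<open>(z, 0)\<close> to \<open>(z, v)\<close> in logarithmic
      time \<open>v\<close> without completing a period, so no power of \<open>b1 z\<close> appears.
      Semi-additivity then expresses \<open>jc c (z, v)\<close> through \<open>J z\<close> at
      \<open>v\<close> and \<open>v + ln c\<close>.\<close>
    have "cyclic_flow q (exp v) (z, 0) = (z, v)" and "ipart (q z) v = 0"
      using v q by (simp_all add: cyclic_flow_def fpart_ident ipart_eq_floor floor_eq_iff)
    then have "J z (v + ln c) = exp (- \<kappa> * ln c) * J z v + b (z, v) / b (z, 0) * jc c (z, v)"
      using sa[of "exp v" c "(z, 0)"] bc[of "exp v" z 0] X[of 0] q c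
      by (simp add: J_def exp_add)
    moreover have "b (z, 0) * b (z, 0) = 1" using bsq q by simp
    ultimately have "jc c (z, v) =
        b (z, 0) / b (z, v) * (J z (v + ln c) - exp (- \<kappa> * ln c) * J z v)"
      using bsq[OF v] bsq[of 0] q by (simp add: field_simps)
    also have "J z (v + ln c) =
        b1 z powi n * (J z w + A z * exp (- \<kappa> * w)) - A z * exp (- \<kappa> * (v + ln c))
        + of_int n * J z (q z) * of_bool (b1 z = 1) * of_bool (\<kappa> = 0)"
      unfolding nw A_def by (rule semi_additive_along_periodic_orbit[OF q \<beta> per])
    \<comment> \<open>With this factorization the \<open>A z\<close> term joins \<open>J z v\<close>
      and completes \<open>j (z, v)\<close>.\<close>
    also have "exp (- \<kappa> * (v + ln c)) = exp (- \<kappa> * ln c) * exp (- \<kappa> * v)"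
      by (simp add: exp_add [symmetric] algebra_simps)
    finally have "jc c (z, v) =
        b1 z powi n * (b (z, 0) * (J z w + A z * exp (- \<kappa> * w)) / b (z, v))
        - exp (- \<kappa> * ln c) * j (z, v)
        + j1 z / b (z, v) * of_int n * of_bool (b1 z = 1) * of_bool (\<kappa> = 0)"
      by (simp add: j_def j1_def algebra_simps add_divide_distrib diff_divide_distrib)
    moreover have "c powr (- (H - 1 / \<alpha>)) = exp (- \<kappa> * ln c)"
      using c by (simp add: powr_def \<kappa>_def)
    \<comment> \<open>The denominator \<open>b (z, w)\<close> in \<open>j (z, w)\<close> cancels
      against the cocycle.\<close>
    moreover have "b (z, w) / b (z, v) * j (z, w) =
        b (z, 0) * (J z w + A z * exp (- \<kappa> * w)) / b (z, v)"
      using bsq(2)[OF w] by (simp add: j_def)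
    moreover have "\<kappa> = 0 \<longleftrightarrow> H = 1 / \<alpha>" by (simp add: \<kappa>_def)
    ultimately show ?thesis
      by (simp only: flow n_def [symmetric] mult.assoc)
  qed
  then show ?thesis
    by (intro exI[of _ j1] exI[of _ j]) blast
qed

end
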